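(* For every integer $n\ge 0$, the Möbius function of the Rees product of the cubical lattice with the chain is given by $$\mu(\operatorname{Rees}(\mathscr{C}_n,C_{n+1}))=-1+\sum_{i=0}^{n}(-1)^{n-i}\cdot 2^{n-i}\binom{n}{i}(i+1)\,(n-i)!.$$
   Context: $\mu(P)$ denotes the Möbius function value $\mu_P(\hat 0,\hat 1)$ of a finite poset $P$ with minimum $\hat 0$ and maximum $\hat 1$. $\mathscr{C}_n$ is the cubical lattice: the face lattice of the $n$-dimensional cube (including the empty face $\hat 0$), of rank $n+1$. $C_{n+1}$ is the chain on $n+1$ elements. Rees product: for posets $P,Q$ with rank functions $\rho$ (minimal elements having rank $0$), $P*Q$ is the set of pairs $(p,q)\in P\times Q$ with $\rho(p)\ge\rho(q)$, ordered by $(p,q)\le(p',q')$ iff $p\le_P p'$, $q\le_Q q'$ and $\rho(p')-\rho(p)\ge\rho(q')-\rho(q)$. For $P$ graded with minimum $\hat 0$ and maximum $\hat 1$, $\operatorname{Rees}(P,Q)=((P-\{\hat 0\})*Q)\cup\{\hat 0,\hat 1\}$, where a new minimum $\hat 0$ and a new maximum $\hat 1$ are adjoined, and where in $P-\{\hat 0\}$ the atoms of $P$ have rank $0$. *)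

theory Defs
  imports
    "HOL-Algebra.Order"
    "HOL-Analysis.Finite_Function_Topology"
    "HOL-Analysis.Polytope"
begin

section \<open>The Moebius function of a finite poset\<close>

text \<open>
  The recursion is \<open>\<mu>(x,x) = 1\<close> and \<open>\<mu>(x,y) = - (\<Sum>x \<le> z < y. \<mu>(x,z))\<close> for \<open>x < y\<close>.
  The guard makes it terminate; the value is \<open>0\<close> outside of finite posets and
  for pairs with \<open>x \<notle> y\<close>.
\<close>

function moebius :: "('a, 'b) gorder_scheme \<Rightarrow> 'a \<Rightarrow> 'a \<Rightarrow> int" where
  "moebius L x y =
     (if partial_order L \<and> finite (carrier L) \<and> x \<in> carrier L \<and> y \<in> carrier L \<and> x \<sqsubseteq>\<^bsub>L\<^esub> y
      then if x = y then 1
           else - (\<Sum>z \<in> {z \<in> carrier L. x \<sqsubseteq>\<^bsub>L\<^esub> z \<and> z \<sqsubset>\<^bsub>L\<^esub> y}. moebius L x z)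
      else 0)"
  by pat_completeness auto
termination
proof (relation "measure (\<lambda>(L, x, y). card {z \<in> carrier L. z \<sqsubseteq>\<^bsub>L\<^esub> y})")
  fix L :: "('a, 'b) gorder_scheme" and x y z
  assume A: "partial_order L \<and> finite (carrier L) \<and> x \<in> carrier L \<and> y \<in> carrier L \<and> x \<sqsubseteq>\<^bsub>L\<^esub> y"
    and z: "z \<in> {z \<in> carrier L. x \<sqsubseteq>\<^bsub>L\<^esub> z \<and> z \<sqsubset>\<^bsub>L\<^esub> y}"
  interpret partial_order L using A by blast
  have zy: "z \<in> carrier L" "z \<sqsubseteq>\<^bsub>L\<^esub> y" "z \<noteq> y"
    using z by (auto simp: lless_eq)
  have "{w \<in> carrier L. w \<sqsubseteq>\<^bsub>L\<^esub> z} \<subseteq> {w \<in> carrier L. w \<sqsubseteq>\<^bsub>L\<^esub> y}"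
    using zy A le_trans by blast
  moreover have "y \<in> {w \<in> carrier L. w \<sqsubseteq>\<^bsub>L\<^esub> y}" "y \<notin> {w \<in> carrier L. w \<sqsubseteq>\<^bsub>L\<^esub> z}"
    using zy A le_antisym by blast+
  ultimately have "{w \<in> carrier L. w \<sqsubseteq>\<^bsub>L\<^esub> z} \<subset> {w \<in> carrier L. w \<sqsubseteq>\<^bsub>L\<^esub> y}"
    by blast
  then show "((L, x, z), (L, x, y)) \<in> measure (\<lambda>(L, x, y). card {z \<in> carrier L. z \<sqsubseteq>\<^bsub>L\<^esub> y})"
    using A by (auto intro!: psubset_card_mono)
qed auto

declare moebius.simps [simp del]

definition moebius_number :: "('a, 'b) gorder_scheme \<Rightarrow> int" where
  "moebius_number L = moebius L \<bottom>\<^bsub>L\<^esub> \<top>\<^bsub>L\<^esub>"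


section \<open>Rank functions\<close>

definition minimal_in :: "('a, 'b) gorder_scheme \<Rightarrow> 'a \<Rightarrow> bool" where
  "minimal_in L x \<longleftrightarrow> x \<in> carrier L \<and> (\<forall>y \<in> carrier L. \<not> y \<sqsubset>\<^bsub>L\<^esub> x)"

definition covers_in :: "('a, 'b) gorder_scheme \<Rightarrow> 'a \<Rightarrow> 'a \<Rightarrow> bool" where
  "covers_in L y x \<longleftrightarrow> x \<in> carrier L \<and> y \<in> carrier L \<and> x \<sqsubset>\<^bsub>L\<^esub> y \<and>
     (\<forall>z \<in> carrier L. \<not> (x \<sqsubset>\<^bsub>L\<^esub> z \<and> z \<sqsubset>\<^bsub>L\<^esub> y))"

definition is_rank_function :: "('a, 'b) gorder_scheme \<Rightarrow> ('a \<Rightarrow> nat) \<Rightarrow> bool" where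
  "is_rank_function L \<rho> \<longleftrightarrow>
     (\<forall>x. minimal_in L x \<longrightarrow> \<rho> x = 0) \<and>
     (\<forall>x y. covers_in L y x \<longrightarrow> \<rho> y = Suc (\<rho> x))"

text \<open>
  On a finite poset there is at most one rank function up to its values outside of the
  carrier, see \<open>is_rank_function_unique\<close>, so the choice below is harmless.
\<close>

definition poset_rank :: "('a, 'b) gorder_scheme \<Rightarrow> 'a \<Rightarrow> nat" where
  "poset_rank L = (SOME \<rho>. is_rank_function L \<rho>)"

lemma is_rank_function_unique:
  assumes po: "partial_order L" and fin: "finite (carrier L)"
    and r: "is_rank_function L \<rho>" "is_rank_function L \<rho>'"
    and x: "x \<in> carrier L"
  shows "\<rho> x = \<rho>' x"
proof -
  interpret partial_order L by fact
  let ?d = "\<lambda>x. {z \<in> carrier L. z \<sqsubseteq>\<^bsub>L\<^esub> x}"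
  have less: "card (?d z) < card (?d y)"
    if "z \<in> carrier L" "y \<in> carrier L" "z \<sqsubset>\<^bsub>L\<^esub> y" for z y
  proof (rule psubset_card_mono)
    show "finite (?d y)" using fin by simp
    have "?d z \<subseteq> ?d y" using that le_trans unfolding lless_eq by blast
    moreover have "y \<in> ?d y" "y \<notin> ?d z" using that le_antisym unfolding lless_eq by blast+
    ultimately show "?d z \<subset> ?d y" by blast
  qed
  show ?thesis using x
  proof (induction "card (?d x)" arbitrary: x rule: less_induct)
    case less_x: less
    show ?case
    proof (cases "minimal_in L x")
      case True
      then show ?thesis using r by (simp add: is_rank_function_def)
    next
      case False
      let ?S = "{z \<in> carrier L. z \<sqsubset>\<^bsub>L\<^esub> x}"
      have "finite ?S" "?S \<noteq> {}" using False less_x.prems fin by (auto simp: minimal_in_def)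
      define M where "M = Max ((\<lambda>w. card (?d w)) ` ?S)"
      have "M \<in> (\<lambda>w. card (?d w)) ` ?S"
        unfolding M_def using \<open>finite ?S\<close> \<open>?S \<noteq> {}\<close> by (intro Max_in) blast+
      then obtain z where z: "z \<in> carrier L" "z \<sqsubset>\<^bsub>L\<^esub> x" and M: "M = card (?d z)"
        by blast
      have mx: "card (?d w) \<le> card (?d z)" if "w \<in> carrier L" "w \<sqsubset>\<^bsub>L\<^esub> x" for w
        unfolding M[symmetric] M_def using \<open>finite ?S\<close> that by (intro Max_ge) blast+
      have "\<not> (z \<sqsubset>\<^bsub>L\<^esub> w \<and> w \<sqsubset>\<^bsub>L\<^esub> x)" if "w \<in> carrier L" for w
        using less[OF z(1) that] mx[OF that] by linarith
      then have "covers_in L x z"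
        unfolding covers_in_def using z less_x.prems by blast
      then have "\<rho> x = Suc (\<rho> z)" "\<rho>' x = Suc (\<rho>' z)"
        using r by (auto simp: is_rank_function_def)
      moreover have "\<rho> z = \<rho>' z"
        using less_x.hyps[OF less[OF z(1) less_x.prems z(2)] z(1)] .
      ultimately show ?thesis by simp
    qed
  qed
qed


section \<open>Rees products\<close>

definition rees_star :: "('a, 'c) gorder_scheme \<Rightarrow> ('b, 'd) gorder_scheme \<Rightarrow> ('a \<times> 'b) gorder" where
  "rees_star P Q =
     \<lparr>carrier = {(p, q). p \<in> carrier P \<and> q \<in> carrier Q \<and> poset_rank P p \<ge> poset_rank Q q},
      eq = (=),
      le = (\<lambda>(p, q) (p', q'). p \<sqsubseteq>\<^bsub>P\<^esub> p' \<and> q \<sqsubseteq>\<^bsub>Q\<^esub> q' \<and>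
             int (poset_rank P p') - int (poset_rank P p)
               \<ge> int (poset_rank Q q') - int (poset_rank Q q))\<rparr>"

definition remove_bottom :: "('a, 'b) gorder_scheme \<Rightarrow> ('a, 'b) gorder_scheme" where
  "remove_bottom P = P\<lparr>carrier := carrier P - {\<bottom>\<^bsub>P\<^esub>}\<rparr>"

datatype 'a bounded_ext = Hat0 | Inner 'a | Hat1

definition adjoin_bounds :: "('a, 'b) gorder_scheme \<Rightarrow> 'a bounded_ext gorder" where
  "adjoin_bounds P =
     \<lparr>carrier = {Hat0, Hat1} \<union> Inner ` carrier P,
      eq = (=),
      le = (\<lambda>x y. x = Hat0 \<or> y = Hat1 \<or> (\<exists>a b. x = Inner a \<and> y = Inner b \<and> a \<sqsubseteq>\<^bsub>P\<^esub> b))\<rparr>"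

definition Rees :: "('a, 'c) gorder_scheme \<Rightarrow> ('b, 'd) gorder_scheme \<Rightarrow> ('a \<times> 'b) bounded_ext gorder" where
  "Rees P Q = adjoin_bounds (rees_star (remove_bottom P) Q)"


section \<open>The cubical lattice and the chain\<close>

text \<open>
  The finitely supported real sequences form a real vector space containing every
  \<open>\<real>\<^sup>n\<close> (the sequences vanishing from index \<open>n\<close> on), so the dimension of the cube can
  be an arbitrary natural number, including \<open>0\<close>.
\<close>

definition unit_cube :: "nat \<Rightarrow> (nat \<Rightarrow>\<^sub>0 real) set" where
  "unit_cube n =
     {x. (\<forall>i<n. 0 \<le> Poly_Mapping.lookup x i \<and> Poly_Mapping.lookup x i \<le> 1) \<and> (\<forall>i\<ge>n. Poly_Mapping.lookup x i = 0)}"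

text \<open>Both \<open>{}\<close> and the whole cube are faces in the sense of \<open>face_of\<close>.\<close>

definition cubical_lattice :: "nat \<Rightarrow> (nat \<Rightarrow>\<^sub>0 real) set gorder" where
  "cubical_lattice n = \<lparr>carrier = {F. F face_of unit_cube n}, eq = (=), le = (\<subseteq>)\<rparr>"

text \<open>The argument is the number of elements, not the length of the chain.\<close>

definition chain_poset :: "nat \<Rightarrow> nat gorder" where
  "chain_poset m = \<lparr>carrier = {..<m}, eq = (=), le = (\<le>)\<rparr>"

end

theory Submission
  imports Defs
begin

text \<open>
  The Moebius number is computed from the top. In the Rees product of the cubical lattice with a
  chain, the elements above \<open>(F, k)\<close>, apart from the maximum, are the pairs \<open>(G, l)\<close> with \<open>F \<subseteq> G\<close> and
  \<open>k \<le> l \<le> k + (dim G - dim F)\<close>. The faces above \<open>F\<close> form a Boolean lattice of rank \<open>c\<close>, the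
  codimension of \<open>F\<close>, so this upper part of the poset depends only on \<open>c\<close>. Therefore the Moebius
  value from \<open>(F, k)\<close> to the maximum is a number \<open>g c\<close> with
  \<open>1 + (\<Sum>i\<le>c. (c choose i) * (i + 1) * g (c - i)) = 0\<close>, and the solution of this recursion is
  \<open>g c = - (- 1) ^ c * fact c\<close> by \<open>alternating_sum_eq_1\<close>. The cube has
  \<open>2 ^ (n - i) * (n choose i)\<close> faces of dimension \<open>i\<close>, each of which occurs with \<open>i + 1\<close> chain
  elements. The Moebius number is minus the sum of \<open>1\<close>, for the maximum, and of
  \<open>2 ^ (n - i) * (n choose i) * (i + 1) * g (n - i)\<close> over all \<open>i\<close>, which is the asserted formula.

  Two facts make this rigorous. The Moebius function is defined by a recursion from below;
  \<open>moebius_eqI_dual\<close> shows that the recursion from above determines it as well. And the faces of the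
  cube, given as convex sets, have to be described combinatorially: by \<open>face_of_cubeE\<close> and
  \<open>cube_face_subset_iff\<close>, the nonempty faces correspond to partial maps from the coordinates
  to the two values \<open>0\<close> and \<open>1\<close>, ordered by reverse extension, and by \<open>poset_rank_cube_face\<close>
  the rank of a face is the number of coordinates that are not fixed.
\<close>

section \<open>Computing the Moebius function from above\<close>

lemma moebius_sum:
  assumes po: "partial_order L" and fin: "finite (carrier L)"
    and x: "x \<in> carrier L" and y: "y \<in> carrier L" and xy: "x \<sqsubseteq>\<^bsub>L\<^esub> y"
  shows "(\<Sum>z\<in>{z \<in> carrier L. x \<sqsubseteq>\<^bsub>L\<^esub> z \<and> z \<sqsubseteq>\<^bsub>L\<^esub> y}. moebius L x z) = of_bool (x = y)"
proof -
  interpret partial_order L by fact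
  have *: "{z \<in> carrier L. x \<sqsubseteq>\<^bsub>L\<^esub> z \<and> z \<sqsubseteq>\<^bsub>L\<^esub> y} =
      insert y {z \<in> carrier L. x \<sqsubseteq>\<^bsub>L\<^esub> z \<and> z \<sqsubset>\<^bsub>L\<^esub> y}"
    using y xy by (auto simp: lless_eq)
  have y_notin: "y \<notin> {z \<in> carrier L. x \<sqsubseteq>\<^bsub>L\<^esub> z \<and> z \<sqsubset>\<^bsub>L\<^esub> y}"
    by (simp add: lless_eq)
  show ?thesis
  proof (cases "x = y")
    case True
    then have "{z \<in> carrier L. x \<sqsubseteq>\<^bsub>L\<^esub> z \<and> z \<sqsubseteq>\<^bsub>L\<^esub> y} = {y}"
      using y le_antisym by auto
    then show ?thesis
      using True y po fin by (simp add: moebius.simps[of L y y])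
  next
    case False
    have "moebius L x y = - (\<Sum>z \<in> {z \<in> carrier L. x \<sqsubseteq>\<^bsub>L\<^esub> z \<and> z \<sqsubset>\<^bsub>L\<^esub> y}. moebius L x z)"
      using False assms by (subst moebius.simps) simp
    then show ?thesis
      using False fin y_notin by (simp only: *) simp
  qed
qed

text \<open>
  In the incidence algebra, \<open>moebius L\<close> is a left inverse of the zeta function, and left and
  right inverses agree. Concretely, the sum of \<open>moebius L x z * g w\<close> over all
  \<open>x \<le> z \<le> w \<le> y\<close> collapses to \<open>moebius L x y\<close> or to \<open>g x\<close>, depending on which summation is
  carried out first. This allows the Moebius function to be computed downwards from \<open>y\<close>.
\<close>

lemma moebius_eqI_dual:
  assumes po: "partial_order L" and fin: "finite (carrier L)"
    and x: "x \<in> carrier L" and y: "y \<in> carrier L" and xy: "x \<sqsubseteq>\<^bsub>L\<^esub> y"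
    and g: "\<And>z. z \<in> carrier L \<Longrightarrow> x \<sqsubseteq>\<^bsub>L\<^esub> z \<Longrightarrow> z \<sqsubseteq>\<^bsub>L\<^esub> y \<Longrightarrow>
      (\<Sum>w\<in>{w \<in> carrier L. z \<sqsubseteq>\<^bsub>L\<^esub> w \<and> w \<sqsubseteq>\<^bsub>L\<^esub> y}. g w) = of_bool (z = y)"
  shows "moebius L x y = g x"
proof -
  interpret partial_order L by fact
  define I where "I = {z \<in> carrier L. x \<sqsubseteq>\<^bsub>L\<^esub> z \<and> z \<sqsubseteq>\<^bsub>L\<^esub> y}"
  have finI: "finite I" and xI: "x \<in> I" and yI: "y \<in> I"
    using fin x y xy by (auto simp: I_def)
  have up: "{w \<in> I. z \<sqsubseteq>\<^bsub>L\<^esub> w} = {w \<in> carrier L. z \<sqsubseteq>\<^bsub>L\<^esub> w \<and> w \<sqsubseteq>\<^bsub>L\<^esub> y}" if "z \<in> I" for z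
    using that x y le_trans unfolding I_def by blast
  have up_sum: "(\<Sum>w\<in>{w \<in> I. z \<sqsubseteq>\<^bsub>L\<^esub> w}. g w) = of_bool (z = y)" if "z \<in> I" for z
    unfolding up[OF that] using that by (intro g) (auto simp: I_def)
  have down: "{z \<in> I. z \<sqsubseteq>\<^bsub>L\<^esub> w} = {z \<in> carrier L. x \<sqsubseteq>\<^bsub>L\<^esub> z \<and> z \<sqsubseteq>\<^bsub>L\<^esub> w}" if "w \<in> I" for w
    using that x y le_trans unfolding I_def by blast
  have "moebius L x y = (\<Sum>z\<in>I. moebius L x z * of_bool (z = y))"
    using finI yI by simp
  also have "\<dots> = (\<Sum>z\<in>I. moebius L x z * (\<Sum>w\<in>{w \<in> I. z \<sqsubseteq>\<^bsub>L\<^esub> w}. g w))"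
    by (intro sum.cong HOL.refl) (simp only: up_sum)
  also have "\<dots> = (\<Sum>z\<in>I. \<Sum>w\<in>{w \<in> I. z \<sqsubseteq>\<^bsub>L\<^esub> w}. moebius L x z * g w)"
    by (simp add: sum_distrib_left)
  also have "\<dots> = (\<Sum>w\<in>I. \<Sum>z\<in>{z \<in> I. z \<sqsubseteq>\<^bsub>L\<^esub> w}. moebius L x z * g w)"
    by (rule sum.swap_restrict[OF finI finI])
  also have "\<dots> = (\<Sum>w\<in>I. (\<Sum>z\<in>{z \<in> I. z \<sqsubseteq>\<^bsub>L\<^esub> w}. moebius L x z) * g w)"
    by (simp add: sum_distrib_right)
  also have "\<dots> = (\<Sum>w\<in>I. of_bool (x = w) * g w)"
    by (intro sum.cong HOL.refl) (simp only: down, simp add: I_def moebius_sum[OF po fin x])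
  also have "\<dots> = g x"
    using finI xI by simp
  finally show ?thesis .
qed

section \<open>Rees products of partial orders\<close>

lemma poset_rank_eqI:
  assumes "partial_order L" "finite (carrier L)" "is_rank_function L \<rho>" "x \<in> carrier L"
  shows "poset_rank L x = \<rho> x"
proof -
  have "is_rank_function L (poset_rank L)"
    using someI[of "is_rank_function L", OF assms(3)] by (simp add: poset_rank_def)
  then show ?thesis
    using assms by (intro is_rank_function_unique)
qed

lemma partial_order_rees_star:
  assumes "partial_order P" "partial_order Q"
  shows "partial_order (rees_star P Q)"
proof -
  interpret P: partial_order P by fact
  interpret Q: partial_order Q by fact
  show ?thesis
    by unfold_locales
      (auto simp: rees_star_def dest: P.le_antisym Q.le_antisym intro: P.le_trans Q.le_trans)
qed

lemma partial_order_adjoin_bounds: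
  assumes "partial_order P"
  shows "partial_order (adjoin_bounds P)"
proof -
  interpret P: partial_order P by fact
  show ?thesis
    by unfold_locales (auto simp: adjoin_bounds_def dest: P.le_antisym intro: P.le_trans)
qed

lemma bottom_eqI:
  assumes "partial_order L" "b \<in> carrier L" "\<And>x. x \<in> carrier L \<Longrightarrow> b \<sqsubseteq>\<^bsub>L\<^esub> x"
  shows "\<bottom>\<^bsub>L\<^esub> = b"
proof -
  interpret partial_order L by fact
  have "least L b (carrier L)" using assms by (auto simp: least_def)
  then have "least L (\<bottom>\<^bsub>L\<^esub>) (carrier L)" unfolding bottom_def by (rule someI)
  then show ?thesis using assms(2,3) by (auto simp: least_def intro!: le_antisym)
qed

lemma top_eqI:
  assumes "partial_order L" "t \<in> carrier L" "\<And>x. x \<in> carrier L \<Longrightarrow> x \<sqsubseteq>\<^bsub>L\<^esub> t"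
  shows "\<top>\<^bsub>L\<^esub> = t"
proof -
  interpret partial_order L by fact
  have "greatest L t (carrier L)" using assms by (auto simp: greatest_def)
  then have "greatest L (\<top>\<^bsub>L\<^esub>) (carrier L)" unfolding top_def by (rule someI)
  then show ?thesis using assms(2,3) by (auto simp: greatest_def intro!: le_antisym)
qed

text \<open>
  Here \<open>g p\<close> is the Moebius value from \<open>p\<close> to the new maximum: the maximum itself contributes \<open>1\<close>
  to the sum over the elements above \<open>p\<close>, so the rest must contribute \<open>- 1\<close>.
\<close>

lemma moebius_number_adjoin_bounds:
  fixes g :: "'a \<Rightarrow> int"
  assumes po: "partial_order P" and fin: "finite (carrier P)"
    and g: "\<And>p. p \<in> carrier P \<Longrightarrow> (\<Sum>q\<in>{q \<in> carrier P. p \<sqsubseteq>\<^bsub>P\<^esub> q}. g q) = - 1"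
  shows "moebius_number (adjoin_bounds P) = - 1 - (\<Sum>p\<in>carrier P. g p)"
proof -
  let ?L = "adjoin_bounds P"
  define h where "h x = (case x of Hat0 \<Rightarrow> - 1 - (\<Sum>p\<in>carrier P. g p) | Inner p \<Rightarrow> g p | Hat1 \<Rightarrow> 1)"
    for x
  have po': "partial_order ?L" by (rule partial_order_adjoin_bounds[OF po])
  have bot: "\<bottom>\<^bsub>?L\<^esub> = Hat0"
    by (rule bottom_eqI[OF po']) (auto simp: adjoin_bounds_def)
  have top: "\<top>\<^bsub>?L\<^esub> = Hat1"
    by (rule top_eqI[OF po']) (auto simp: adjoin_bounds_def)
  have "moebius ?L Hat0 Hat1 = h Hat0"
  proof (rule moebius_eqI_dual[OF po'])
    show "finite (carrier ?L)" using fin by (simp add: adjoin_bounds_def)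
    fix z assume "z \<in> carrier ?L"
    then consider "z = Hat0" | p where "z = Inner p" "p \<in> carrier P" | "z = Hat1"
      by (auto simp: adjoin_bounds_def)
    then show "(\<Sum>w\<in>{w \<in> carrier ?L. z \<sqsubseteq>\<^bsub>?L\<^esub> w \<and> w \<sqsubseteq>\<^bsub>?L\<^esub> Hat1}. h w) = of_bool (z = Hat1)"
    proof cases
      case 1
      have *: "{w \<in> carrier ?L. z \<sqsubseteq>\<^bsub>?L\<^esub> w \<and> w \<sqsubseteq>\<^bsub>?L\<^esub> Hat1} = insert Hat0 (insert Hat1 (Inner ` carrier P))"
        using 1 by (auto simp: adjoin_bounds_def)
      show ?thesis
        unfolding * using 1 fin by (subst sum.insert) (auto simp: h_def sum.reindex inj_on_def image_iff)
    next
      case 2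
      have *: "{w \<in> carrier ?L. z \<sqsubseteq>\<^bsub>?L\<^esub> w \<and> w \<sqsubseteq>\<^bsub>?L\<^esub> Hat1} =
          insert Hat1 (Inner ` {q \<in> carrier P. p \<sqsubseteq>\<^bsub>P\<^esub> q})"
        using 2 by (auto simp: adjoin_bounds_def)
      show ?thesis
        unfolding * using 2 fin by (subst sum.insert) (auto simp: h_def sum.reindex inj_on_def g)
    next
      case 3
      have *: "{w \<in> carrier ?L. z \<sqsubseteq>\<^bsub>?L\<^esub> w \<and> w \<sqsubseteq>\<^bsub>?L\<^esub> Hat1} = {Hat1}"
        using 3 by (auto simp: adjoin_bounds_def)
      show ?thesis unfolding * using 3 by (simp add: h_def)
    qed
  qed (auto simp: adjoin_bounds_def)
  then show ?thesis
    by (simp add: moebius_number_def bot top h_def)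
qed

section \<open>The faces of the cube\<close>

text \<open>
  A nonempty face is encoded by a partial map that records the coordinates which are fixed on the
  face, together with their values \<open>0\<close> (\<open>False\<close>) or \<open>1\<close> (\<open>True\<close>).
\<close>

definition cube_face :: "nat \<Rightarrow> (nat \<rightharpoonup> bool) \<Rightarrow> (nat \<Rightarrow>\<^sub>0 real) set" where
  "cube_face n m = {x \<in> unit_cube n. \<forall>i b. m i = Some b \<longrightarrow> Poly_Mapping.lookup x i = of_bool b}"

lemma lookup_scaleR: "Poly_Mapping.lookup (r *\<^sub>R x) i = r *\<^sub>R Poly_Mapping.lookup x i"
  for x :: "'a \<Rightarrow>\<^sub>0 'b::real_vector"
proof -
  have "finite {i. r *\<^sub>R Poly_Mapping.lookup x i \<noteq> 0}"
    by (rule finite_subset[OF _ finite_lookup[of x]]) auto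
  then show ?thesis by (simp add: scaleR_poly_mapping_def)
qed

lemma convex_unit_cube: "convex (unit_cube n)"
  unfolding convex_alt unit_cube_def
  by (auto simp: lookup_add lookup_scaleR intro!: convex_bound_le)

lemma convex_cube_face: "convex (cube_face n m)"
  using convex_unit_cube[of n]
  unfolding convex_alt cube_face_def
  by (auto simp: lookup_add lookup_scaleR)

text \<open>
  The values \<open>0\<close> and \<open>1\<close> are extreme in the unit interval: if a proper convex combination of two
  numbers in the interval attains such a value, then so do both numbers.
\<close>

lemma cube_face_face_of:
  assumes "dom m \<subseteq> {..<n}"
  shows "cube_face n m face_of unit_cube n"
  unfolding face_of_def
proof (intro conjI ballI impI convex_cube_face)
  show "cube_face n m \<subseteq> unit_cube n" by (auto simp: cube_face_def)
  fix a b x assume a: "a \<in> unit_cube n" and b: "b \<in> unit_cube n" and x: "x \<in> cube_face n m"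
    and "x \<in> open_segment a b"
  then obtain u where u: "0 < u" "u < 1" and xu: "x = (1 - u) *\<^sub>R a + u *\<^sub>R b"
    by (auto simp: in_segment)
  have "Poly_Mapping.lookup a i = of_bool c \<and> Poly_Mapping.lookup b i = of_bool c"
    if mi: "m i = Some c" for i c
  proof -
    define s t where "s = Poly_Mapping.lookup a i" and "t = Poly_Mapping.lookup b i"
    have "i < n" using mi assms by auto
    then have st: "0 \<le> s" "s \<le> 1" "0 \<le> t" "t \<le> 1"
      using a b by (auto simp: unit_cube_def s_def t_def)
    have eq: "(1 - u) * s + u * t = of_bool c"
      using x mi by (auto simp: cube_face_def xu lookup_add lookup_scaleR s_def t_def)
    show ?thesis
    proof (cases c)
      case False
      then have "(1 - u) * s = 0" "u * t = 0"
        using eq st u by (simp_all add: add_nonneg_eq_0_iff)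
      then show ?thesis using u False by (simp add: s_def t_def)
    next
      case True
      then have "(1 - u) * (1 - s) + u * (1 - t) = 0"
        using eq by (simp add: algebra_simps)
      then have "(1 - u) * (1 - s) = 0" "u * (1 - t) = 0"
        using st u by (simp_all add: add_nonneg_eq_0_iff)
      then show ?thesis using u True by (simp add: s_def t_def)
    qed
  qed
  then show "a \<in> cube_face n m" "b \<in> cube_face n m"
    using a b by (auto simp: cube_face_def)
qed

text \<open>
  Fix exactly those coordinates that are constantly \<open>0\<close> or constantly \<open>1\<close> on \<open>F\<close>. Averaging points
  of \<open>F\<close> gives a point \<open>p \<in> F\<close> whose free coordinates all lie strictly between \<open>0\<close> and \<open>1\<close>. For
  every \<open>q\<close> in the candidate face, the segment from \<open>q\<close> to \<open>p\<close> can be prolonged slightly beyond \<open>p\<close>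
  inside the cube, so the face property of \<open>F\<close> forces \<open>q \<in> F\<close>.
\<close>

lemma face_of_cubeE:
  assumes F: "F face_of unit_cube n" and ne: "F \<noteq> {}"
  obtains m where "dom m \<subseteq> {..<n}" "F = cube_face n m"
proof -
  have sub: "F \<subseteq> unit_cube n" and cF: "convex F" using F by (auto simp: face_of_def)
  let ?l = "Poly_Mapping.lookup"
  define m where "m i = (if i < n \<and> (\<forall>x\<in>F. ?l x i = 0) then Some False
      else if i < n \<and> (\<forall>x\<in>F. ?l x i = 1) then Some True else None)" for i
  have mid: "(1/2) *\<^sub>R (x + y) \<in> F" if "x \<in> F" "y \<in> F" for x y
    using that convexD[OF cF, of x y "1/2" "1/2"] by (simp add: scaleR_add_right)
  have bnd: "0 \<le> ?l x i \<and> ?l x i \<le> 1" if "x \<in> F" "i < n" for x i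
    using sub that by (auto simp: unit_cube_def)
  have "\<exists>p\<in>F. \<forall>i\<in>S. 0 < ?l p i \<and> ?l p i < 1"
    if "finite S" "S \<subseteq> {i. i < n \<and> m i = None}" for S
    using that
  proof (induction S)
    case empty
    then show ?case using ne by auto
  next
    case (insert j S)
    then obtain p where p: "p \<in> F" "\<And>i. i \<in> S \<Longrightarrow> 0 < ?l p i \<and> ?l p i < 1" by auto
    have j: "j < n" and "m j = None" using insert by auto
    then obtain x y where x: "x \<in> F" "?l x j \<noteq> 0" and y: "y \<in> F" "?l y j \<noteq> 1"
      by (auto simp: m_def split: if_splits)
    \<comment> \<open>A coordinate that is strictly inside for one of two points remains so for their midpoint; in direction \<open>j\<close>, averaging \<open>x\<close> and \<open>y\<close> leaves both ends.\<close>
    define q where "q = (1/2) *\<^sub>R (p + (1/2) *\<^sub>R (x + y))"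
    have q: "?l q i = ?l p i / 2 + ?l x i / 4 + ?l y i / 4" for i
      by (simp add: q_def lookup_add lookup_scaleR)
    have "q \<in> F" unfolding q_def by (intro mid p x y)
    moreover have "0 < ?l q i \<and> ?l q i < 1" if "i \<in> insert j S" for i
    proof -
      have "i < n" using that insert.prems by auto
      note b = bnd[OF p(1) this] bnd[OF x(1) this] bnd[OF y(1) this]
      show ?thesis
      proof (cases "i = j")
        case True
        then show ?thesis using b x(2) y(2) unfolding q by auto
      next
        case False
        then show ?thesis using b p(2)[of i] that unfolding q by auto
      qed
    qed
    ultimately show ?case by blast
  qed
  from this[of "{i. i < n \<and> m i = None}"] obtain p
    where p: "p \<in> F" "\<And>i. i < n \<Longrightarrow> m i = None \<Longrightarrow> 0 < ?l p i \<and> ?l p i < 1"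
    by auto
  have sub1: "F \<subseteq> cube_face n m"
    using sub by (auto simp: cube_face_def m_def split: if_splits)
  have sub2: "cube_face n m \<subseteq> F"
  proof
    fix q assume q: "q \<in> cube_face n m"
    show "q \<in> F"
    proof (cases "q = p")
      case False
      let ?S = "{i. i < n \<and> m i = None}"
      \<comment> \<open>The distance of \<open>p\<close> from the boundary in the free directions bounds the admissible prolongation; the extra \<open>1\<close> covers the case without free directions.\<close>
      define e where "e = Min (insert 1 ((\<lambda>i. min (?l p i) (1 - ?l p i)) ` ?S))"
      have e: "e > 0" unfolding e_def using p(2) by (subst Min_gr_iff) auto
      have e2: "e \<le> ?l p i" "e \<le> 1 - ?l p i" if "i < n" "m i = None" for i
      proof -
        have "e \<le> min (?l p i) (1 - ?l p i)"
          unfolding e_def using that by (intro Min_le) auto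
        then show "e \<le> ?l p i" "e \<le> 1 - ?l p i" by auto
      qed
      define r where "r = p + e *\<^sub>R (p - q)"
      have r: "?l r i = ?l p i + e * (?l p i - ?l q i)" for i
        by (simp add: r_def lookup_add lookup_scaleR lookup_minus)
      have qc: "q \<in> unit_cube n" using q by (simp add: cube_face_def)
      have pc: "p \<in> unit_cube n" using p sub by blast
      have rc: "r \<in> unit_cube n"
        unfolding unit_cube_def
      proof (intro CollectI conjI allI impI)
        fix i assume "n \<le> i"
        then show "?l r i = 0" using pc qc by (auto simp: r unit_cube_def)
      next
        fix i assume i: "i < n"
        have qi: "0 \<le> ?l q i" "?l q i \<le> 1" using qc i by (auto simp: unit_cube_def)
        have "0 \<le> ?l r i \<and> ?l r i \<le> 1"
        proof (cases "m i")
          case None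
          have pi: "0 < ?l p i" "?l p i < 1" using p(2)[OF i None] by auto
          have "e * (?l p i - ?l q i) \<le> e * 1" "e * (-1) \<le> e * (?l p i - ?l q i)"
            using e qi pi by (intro mult_left_mono; simp)+
          then show ?thesis using e2[OF i None] by (simp add: r)
        next
          case (Some b)
          then have "?l p i = of_bool b" "?l q i = of_bool b"
            using q p sub1 by (auto simp: cube_face_def)
          then show ?thesis by (simp add: r)
        qed
        then show "0 \<le> ?l r i" "?l r i \<le> 1" by auto
      qed
      define u where "u = 1 / (1 + e)"
      have u: "0 < u" "u < 1" "u + u * e = 1"
        using e by (auto simp: u_def field_simps)
      have "(1 - u) *\<^sub>R q + u *\<^sub>R r = q + (u + u * e) *\<^sub>R (p - q)"
        by (simp add: r_def algebra_simps)
      then have "p = (1 - u) *\<^sub>R q + u *\<^sub>R r"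
        by (simp add: u(3))
      moreover have "q \<noteq> r"
      proof
        assume "q = r"
        then have "(1 + e) *\<^sub>R (p - q) = 0" by (simp add: r_def algebra_simps)
        then show False using e False by simp
      qed
      ultimately have "p \<in> open_segment q r"
        using u unfolding in_segment by blast
      then show ?thesis using face_ofD[OF F] qc rc p(1) by blast
    qed (use p in simp)
  qed
  have "dom m \<subseteq> {..<n}" by (auto simp: m_def split: if_splits)
  then show thesis using that sub1 sub2 by blast
qed

text \<open>
  Every face contains vertices whose free coordinates are prescribed arbitrarily. They witness that
  faces with different fixed coordinates are different.
\<close>

lemma cube_face_vertex:
  assumes "dom m \<subseteq> {..<n}"
  shows "\<exists>x\<in>cube_face n m. \<forall>i<n.
    Poly_Mapping.lookup x i = of_bool (case m i of Some b \<Rightarrow> b | None \<Rightarrow> c i)"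
proof -
  define f :: "nat \<Rightarrow> real" where
    "f i = (if i < n then of_bool (case m i of Some b \<Rightarrow> b | None \<Rightarrow> c i) else 0)" for i
  have "finite {i. f i \<noteq> 0}"
    by (rule finite_subset[of _ "{..<n}"]) (auto simp: f_def)
  then have l: "Poly_Mapping.lookup (Abs_poly_mapping f) = f" by simp
  have "Abs_poly_mapping f \<in> cube_face n m"
    using assms unfolding cube_face_def unit_cube_def l by (auto simp: f_def)
  then show ?thesis by (intro bexI[of _ "Abs_poly_mapping f"]) (auto simp: l f_def)
qed

lemma cube_face_nonempty:
  assumes "dom m \<subseteq> {..<n}"
  shows "cube_face n m \<noteq> {}"
  using cube_face_vertex[OF assms] by blast

lemma cube_face_subset_iff:
  assumes m: "dom m \<subseteq> {..<n}" and m': "dom m' \<subseteq> {..<n}"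
  shows "cube_face n m \<subseteq> cube_face n m' \<longleftrightarrow> m' \<subseteq>\<^sub>m m"
proof
  assume "m' \<subseteq>\<^sub>m m"
  then show "cube_face n m \<subseteq> cube_face n m'"
    by (auto simp: cube_face_def map_le_def dom_def)
next
  assume sub: "cube_face n m \<subseteq> cube_face n m'"
  \<comment> \<open>In its free coordinates this vertex violates every constraint of \<open>m'\<close>.\<close>
  obtain x where x: "x \<in> cube_face n m"
    "\<And>i. i < n \<Longrightarrow> Poly_Mapping.lookup x i = of_bool (case m i of Some b \<Rightarrow> b | None \<Rightarrow> m' i \<noteq> Some True)"
    using cube_face_vertex[OF m, of "\<lambda>i. m' i \<noteq> Some True"] by blast
  show "m' \<subseteq>\<^sub>m m"
    unfolding map_le_def
  proof
    fix i assume i: "i \<in> dom m'"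
    then obtain b where b: "m' i = Some b" by auto
    have "Poly_Mapping.lookup x i = of_bool b" using x sub b by (auto simp: cube_face_def)
    moreover have "i < n" using i m' by auto
    ultimately show "m' i = m i" using x(2)[of i] b
      by (cases b) (auto split: option.splits)
  qed
qed

lemma cube_face_inj:
  assumes "dom m \<subseteq> {..<n}" "dom m' \<subseteq> {..<n}" "cube_face n m = cube_face n m'"
  shows "m = m'"
  using cube_face_subset_iff assms by (metis map_le_antisym order_refl)

section \<open>Rank functions of the cubical lattice and the chain\<close>

lemma finite_maps_into_bool:
  assumes "finite A"
  shows "finite {m :: 'a \<rightharpoonup> bool. dom m \<subseteq> A}"
proof (rule finite_subset)
  show "{m :: 'a \<rightharpoonup> bool. dom m \<subseteq> A} \<subseteq> (\<Union>B\<in>Pow A. {m. dom m = B \<and> ran m \<subseteq> UNIV})"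
    by auto
  show "finite (\<Union>B\<in>Pow A. {m :: 'a \<rightharpoonup> bool. dom m = B \<and> ran m \<subseteq> UNIV})"
    using assms by (intro finite_UN_I finite_set_of_finite_maps) (auto intro: finite_subset)
qed

lemma partial_order_cubical_lattice: "partial_order (cubical_lattice n)"
  by unfold_locales (auto simp: cubical_lattice_def)

lemma carrier_remove_bottom_cubical_lattice:
  "carrier (remove_bottom (cubical_lattice n)) = cube_face n ` {m. dom m \<subseteq> {..<n}}"
proof -
  have "\<bottom>\<^bsub>cubical_lattice n\<^esub> = {}"
    by (rule bottom_eqI[OF partial_order_cubical_lattice]) (auto simp: cubical_lattice_def)
  then have "carrier (remove_bottom (cubical_lattice n)) = {F. F face_of unit_cube n \<and> F \<noteq> {}}"
    by (auto simp: remove_bottom_def cubical_lattice_def)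
  also have "\<dots> = cube_face n ` {m. dom m \<subseteq> {..<n}}"
    by (auto intro: cube_face_face_of elim: face_of_cubeE dest: cube_face_nonempty)
  finally show ?thesis .
qed

lemma le_remove_bottom_cubical_lattice:
  "x \<sqsubseteq>\<^bsub>remove_bottom (cubical_lattice n)\<^esub> y \<longleftrightarrow> x \<subseteq> y"
  "x \<sqsubset>\<^bsub>remove_bottom (cubical_lattice n)\<^esub> y \<longleftrightarrow> x \<subset> y"
  by (auto simp: remove_bottom_def cubical_lattice_def lless_def)

lemma partial_order_remove_bottom_cubical_lattice:
  "partial_order (remove_bottom (cubical_lattice n))"
  by unfold_locales (auto simp: remove_bottom_def cubical_lattice_def)

lemma cube_face_psubset_iff:
  assumes "dom m \<subseteq> {..<n}" "dom m' \<subseteq> {..<n}"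
  shows "cube_face n m \<subset> cube_face n m' \<longleftrightarrow> m' \<subseteq>\<^sub>m m \<and> m \<noteq> m'"
  using cube_face_subset_iff[OF assms] cube_face_subset_iff[OF assms(2,1)] cube_face_inj[OF assms]
  by (auto simp: psubset_eq)

text \<open>
  The rank is the dimension of the face. A face covered by another one fixes exactly one further
  coordinate, because fixing the coordinates of the difference one at a time passes through faces in
  between; a minimal nonempty face is a vertex, where all coordinates are fixed.
\<close>

lemma poset_rank_cube_face:
  assumes m: "dom m \<subseteq> {..<n}"
  shows "poset_rank (remove_bottom (cubical_lattice n)) (cube_face n m) = n - card (dom m)"
proof -
  let ?P = "remove_bottom (cubical_lattice n)"
  let ?M = "{m. dom m \<subseteq> {..<n}}"
  note P = carrier_remove_bottom_cubical_lattice le_remove_bottom_cubical_lattice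
  \<comment> \<open>Among the maps into \<open>bool\<close> with domain in \<open>{..<n}\<close>, the map describing a face is unique, so it can be recovered from the face.\<close>
  define \<rho> where "\<rho> F = n - card (dom (inv_into ?M (cube_face n) F))" for F
  have inj: "inj_on (cube_face n) ?M" by (auto simp: inj_on_def dest: cube_face_inj)
  have \<rho>: "\<rho> (cube_face n m) = n - card (dom m)" if "dom m \<subseteq> {..<n}" for m
    using that by (simp add: \<rho>_def inv_into_f_f[OF inj])
  have "is_rank_function ?P \<rho>"
    unfolding is_rank_function_def
  proof (intro conjI allI impI)
    fix x assume min: "minimal_in ?P x"
    then obtain m where m: "dom m \<subseteq> {..<n}" "x = cube_face n m" by (auto simp: minimal_in_def P)
    have "i \<in> dom m" if "i < n" for i
    proof (rule ccontr)
      assume i: "i \<notin> dom m"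
      let ?m = "m(i \<mapsto> True)"
      have m': "dom ?m \<subseteq> {..<n}" using that m by auto
      have "m \<subseteq>\<^sub>m ?m" "?m \<noteq> m" using i by (auto simp: map_le_def fun_eq_iff)
      then have "cube_face n ?m \<subset> x" using m m' by (simp add: cube_face_psubset_iff)
      then show False using min m' by (auto simp: minimal_in_def P)
    qed
    then have "dom m = {..<n}" using m by auto
    then show "\<rho> x = 0" using m by (simp add: \<rho>)
  next
    fix x y assume cov: "covers_in ?P y x"
    then obtain m m' where m: "dom m \<subseteq> {..<n}" "x = cube_face n m"
      and m': "dom m' \<subseteq> {..<n}" "y = cube_face n m'" by (auto simp: covers_in_def P)
    have "x \<subset> y" using cov by (auto simp: covers_in_def P)
    then have le: "m' \<subseteq>\<^sub>m m" "m \<noteq> m'" using m m' cube_face_psubset_iff by blast+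
    then obtain i where i: "i \<in> dom m" "i \<notin> dom m'"
      by (metis map_le_antisym map_le_def)
    let ?m = "m'(i := m i)"
    have dom: "dom ?m = insert i (dom m')" using i by auto
    then have d: "dom ?m \<subseteq> {..<n}" using m m' i by auto
    have "m' \<subseteq>\<^sub>m ?m" "m' \<noteq> ?m" using i by (auto simp: map_le_def fun_eq_iff)
    then have "cube_face n ?m \<subset> y" using d m' by (simp add: cube_face_psubset_iff)
    then have "\<not> x \<subset> cube_face n ?m" using cov d unfolding covers_in_def P by blast
    moreover have "?m \<subseteq>\<^sub>m m" using le by (auto simp: map_le_def)
    ultimately have eq: "m = ?m" using d m cube_face_psubset_iff by blast
    have fin: "finite (dom m')" using m' finite_subset by blast
    have "card (dom m) = Suc (card (dom m'))" using eq dom fin i by (metis card_insert_disjoint)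
    moreover have "card (dom m) \<le> n" using card_mono[OF _ m(1)] by simp
    ultimately show "\<rho> y = Suc (\<rho> x)" using m m' by (simp add: \<rho>)
  qed
  moreover have "finite (carrier ?P)" by (simp add: P finite_maps_into_bool)
  ultimately show ?thesis
    using m by (subst poset_rank_eqI[OF partial_order_remove_bottom_cubical_lattice, where \<rho>=\<rho>])
      (auto simp: \<rho> P)
qed

lemma partial_order_chain_poset: "partial_order (chain_poset m)"
  by unfold_locales (auto simp: chain_poset_def)

lemma chain_poset_simps:
  "carrier (chain_poset m) = {..<m}"
  "x \<sqsubseteq>\<^bsub>chain_poset m\<^esub> y \<longleftrightarrow> x \<le> y"
  "x \<sqsubset>\<^bsub>chain_poset m\<^esub> y \<longleftrightarrow> x < y"
  by (auto simp: chain_poset_def lless_def)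

lemma poset_rank_chain_poset:
  assumes "k < m"
  shows "poset_rank (chain_poset m) k = k"
proof (rule poset_rank_eqI[OF partial_order_chain_poset])
  show "is_rank_function (chain_poset m) (\<lambda>k. k)"
    unfolding is_rank_function_def
  proof (intro conjI allI impI)
    fix x assume "minimal_in (chain_poset m) x"
    then show "x = 0"
      by (cases x) (auto simp: minimal_in_def chain_poset_simps)
  next
    fix x y assume "covers_in (chain_poset m) y x"
    then have "x < y" "y < m" "\<And>z. z < m \<Longrightarrow> \<not> (x < z \<and> z < y)"
      by (auto simp: covers_in_def chain_poset_simps)
    then show "y = Suc x" by (metis Suc_lessI lessI less_trans)
  qed
qed (use assms in \<open>auto simp: chain_poset_simps\<close>)

section \<open>Counting faces\<close>

lemma sum_Pow_card:
  fixes h :: "nat \<Rightarrow> 'b::comm_semiring_1"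
  assumes "finite A"
  shows "(\<Sum>B\<in>Pow A. h (card B)) = (\<Sum>j\<le>card A. of_nat (card A choose j) * h j)"
proof -
  have "(\<Sum>B\<in>Pow A. h (card B)) = (\<Sum>j\<le>card A. \<Sum>B\<in>{B \<in> Pow A. card B = j}. h (card B))"
    by (rule sum.group[symmetric]) (use assms in \<open>auto intro: card_mono\<close>)
  also have "\<dots> = (\<Sum>j\<le>card A. of_nat (card {B. B \<subseteq> A \<and> card B = j}) * h j)"
    by (intro sum.cong) auto
  finally show ?thesis using assms by (simp add: n_subsets)
qed

text \<open>
  A submap of \<open>m\<close> is determined by its domain: above a face of codimension \<open>c\<close>, the cubical lattice
  is a Boolean lattice of rank \<open>c\<close>.
\<close>

lemma sum_submaps:
  fixes h :: "nat \<Rightarrow> 'b::comm_semiring_1"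
  assumes "finite (dom m)"
  shows "(\<Sum>m'\<in>{m'. m' \<subseteq>\<^sub>m m}. h (card (dom m'))) =
    (\<Sum>j\<le>card (dom m). of_nat (card (dom m) choose j) * h j)"
proof -
  have "(\<Sum>m'\<in>{m'. m' \<subseteq>\<^sub>m m}. h (card (dom m'))) = (\<Sum>B\<in>Pow (dom m). h (card B))"
  proof (rule sum.reindex_bij_witness[of _ "\<lambda>B. m |` B" dom])
    fix m' assume "m' \<in> {m'. m' \<subseteq>\<^sub>m m}"
    then show "m |` dom m' = m'"
      by (intro ext) (metis (lifting) domIff map_le_def mem_Collect_eq restrict_in restrict_out)
  qed (auto simp: map_le_def restrict_map_def dom_def split: if_splits)
  then show ?thesis using assms by (simp add: sum_Pow_card)
qed

lemma card_maps_into_bool: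
  assumes "finite A"
  shows "card {m :: 'a \<rightharpoonup> bool. dom m = A} = 2 ^ card A"
proof -
  have "bij_betw (\<lambda>B i. if i \<in> A then Some (i \<in> B) else None) (Pow A) {m :: 'a \<rightharpoonup> bool. dom m = A}"
    by (rule bij_betw_byWitness[where f' = "\<lambda>m. {i. m i = Some True}"])
      (auto simp: fun_eq_iff dom_def split: if_splits)
  from bij_betw_same_card[OF this] show ?thesis using assms by (simp add: card_Pow)
qed

lemma sum_maps_into_bool:
  fixes h :: "nat \<Rightarrow> 'b::comm_semiring_1"
  assumes "finite A"
  shows "(\<Sum>m\<in>{m :: 'a \<rightharpoonup> bool. dom m \<subseteq> A}. h (card (dom m))) =
    (\<Sum>j\<le>card A. of_nat (card A choose j) * (2 ^ j * h j))"
proof -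
  have "(\<Sum>m\<in>{m :: 'a \<rightharpoonup> bool. dom m \<subseteq> A}. h (card (dom m))) =
      (\<Sum>B\<in>Pow A. \<Sum>m\<in>{m \<in> {m :: 'a \<rightharpoonup> bool. dom m \<subseteq> A}. dom m = B}. h (card (dom m)))"
    by (rule sum.group[symmetric]) (use assms in \<open>auto simp: finite_maps_into_bool\<close>)
  also have "\<dots> = (\<Sum>B\<in>Pow A. \<Sum>m\<in>{m :: 'a \<rightharpoonup> bool. dom m = B}. h (card B))"
    by (intro sum.cong) auto
  also have "\<dots> = (\<Sum>B\<in>Pow A. 2 ^ card B * h (card B))"
    using assms by (intro sum.cong) (auto simp: card_maps_into_bool finite_subset)
  finally show ?thesis using sum_Pow_card[OF assms, of "\<lambda>j. 2 ^ j * h j"] by simp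
qed

text \<open>
  Since \<open>(c choose i) * fact (c - i)\<close> equals \<open>fact c / fact i\<close>, the sum \<open>T c\<close> on the left satisfies
  \<open>T (Suc c) = - Suc c * T c + (Suc c + 1)\<close>, where the last term comes from \<open>i = Suc c\<close>. In terms of
  exponential generating functions, \<open>(1 + x) * exp x\<close> times \<open>1 / (1 + x)\<close> is \<open>exp x\<close>.
\<close>

lemma alternating_sum_eq_1:
  "(\<Sum>i\<le>c. int (c choose i) * (int i + 1) * ((- 1) ^ (c - i) * fact (c - i))) = 1"
proof (induction c)
  case (Suc c)
  have shuffle: "a * s * (- 1 * w * (k * f)) = - (k * a * (s * (w * f)))" for a s w k f :: int
    by simp
  have "(\<Sum>i\<le>c. int (Suc c choose i) * (int i + 1) * ((- 1) ^ (Suc c - i) * fact (Suc c - i))) =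
    (\<Sum>i\<le>c. - int (Suc c) * (int (c choose i) * (int i + 1) * ((- 1) ^ (c - i) * fact (c - i))))"
  proof (intro sum.cong refl)
    fix i assume "i \<in> {..c}"
    then have i: "Suc c - i = Suc (c - i)" by auto
    have "int (Suc (c - i) * (Suc c choose i)) = int (Suc c * (c choose i))"
      using binomial_absorb_comp[of "Suc c" i] unfolding i by (simp only: diff_Suc_1)
    then have absorb: "int (Suc (c - i)) * int (Suc c choose i) = int (Suc c) * int (c choose i)"
      by (simp only: of_nat_mult)
    have "int (Suc c choose i) * (int i + 1) * ((- 1) ^ (Suc c - i) * fact (Suc c - i)) =
        - (int (Suc (c - i)) * int (Suc c choose i) * ((int i + 1) * ((- 1) ^ (c - i) * fact (c - i))))"
      unfolding i fact_Suc power_Suc by (rule shuffle)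
    also have "\<dots> = - int (Suc c) * (int (c choose i) * (int i + 1) * ((- 1) ^ (c - i) * fact (c - i)))"
      unfolding absorb by (simp only: mult.assoc mult_minus_left)
    finally show "int (Suc c choose i) * (int i + 1) * ((- 1) ^ (Suc c - i) * fact (Suc c - i)) =
        - int (Suc c) * (int (c choose i) * (int i + 1) * ((- 1) ^ (c - i) * fact (c - i)))" .
  qed
  also have "\<dots> = - int (Suc c)"
    by (simp only: sum_distrib_left[symmetric] Suc.IH mult_1_right)
  finally show ?case by simp
qed simp

section \<open>The Rees product\<close>

definition cube_star_chain :: "nat \<Rightarrow> ((nat \<Rightarrow>\<^sub>0 real) set \<times> nat) gorder" where
  "cube_star_chain n = rees_star (remove_bottom (cubical_lattice n)) (chain_poset (n + 1))"

lemma partial_order_cube_star_chain: "partial_order (cube_star_chain n)"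
  unfolding cube_star_chain_def
  by (intro partial_order_rees_star partial_order_remove_bottom_cubical_lattice
      partial_order_chain_poset)

lemma mem_cube_star_chain_iff:
  assumes m: "dom m \<subseteq> {..<n}"
  shows "(cube_face n m, k) \<in> carrier (cube_star_chain n) \<longleftrightarrow> k \<le> n - card (dom m)"
proof -
  have "cube_face n m \<in> carrier (remove_bottom (cubical_lattice n))"
    using m by (auto simp: carrier_remove_bottom_cubical_lattice)
  then have "(cube_face n m, k) \<in> carrier (cube_star_chain n) \<longleftrightarrow>
      k < n + 1 \<and> poset_rank (chain_poset (n + 1)) k \<le> n - card (dom m)"
    by (simp add: cube_star_chain_def rees_star_def chain_poset_simps poset_rank_cube_face[OF m])
  then show ?thesis
    by (cases "k < n + 1") (auto simp: poset_rank_chain_poset)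
qed

lemma carrier_cube_star_chain:
  "carrier (cube_star_chain n) =
    (\<lambda>(m, k). (cube_face n m, k)) ` (SIGMA m:{m. dom m \<subseteq> {..<n}}. {..n - card (dom m)})"
proof (intro equalityI subsetI)
  fix q assume q: "q \<in> carrier (cube_star_chain n)"
  then obtain m k where m: "dom m \<subseteq> {..<n}" and qeq: "q = (cube_face n m, k)"
    by (auto simp: cube_star_chain_def rees_star_def carrier_remove_bottom_cubical_lattice)
  then show "q \<in> (\<lambda>(m, k). (cube_face n m, k)) ` (SIGMA m:{m. dom m \<subseteq> {..<n}}. {..n - card (dom m)})"
    using q mem_cube_star_chain_iff[OF m] by (intro image_eqI[of _ _ "(m, k)"]) auto
qed (auto simp: mem_cube_star_chain_iff)

text \<open>
  Ranks are dimensions, so the rank condition of the Rees product bounds the increase of the chain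
  coordinate by the number of coordinates that become free.
\<close>

lemma le_cube_star_chain_iff:
  assumes m: "dom m \<subseteq> {..<n}" "k \<le> n" and m': "dom m' \<subseteq> {..<n}" "k' \<le> n"
  shows "(cube_face n m, k) \<sqsubseteq>\<^bsub>cube_star_chain n\<^esub> (cube_face n m', k') \<longleftrightarrow>
    m' \<subseteq>\<^sub>m m \<and> k \<le> k' \<and> k' \<le> k + (card (dom m) - card (dom m'))"
proof -
  have c: "card (dom m) \<le> n" "card (dom m') \<le> n"
    using card_mono[OF _ m(1)] card_mono[OF _ m'(1)] by auto
  have fin: "finite (dom m)" using m(1) finite_subset by blast
  have mono: "card (dom m') \<le> card (dom m)" if "m' \<subseteq>\<^sub>m m"
    using that fin by (intro card_mono map_le_implies_dom_le)
  have k: "k < n + 1" "k' < n + 1" using m m' by auto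
  have "(cube_face n m, k) \<sqsubseteq>\<^bsub>cube_star_chain n\<^esub> (cube_face n m', k') \<longleftrightarrow>
    m' \<subseteq>\<^sub>m m \<and> k \<le> k' \<and> int k' - int k \<le> int (n - card (dom m')) - int (n - card (dom m))"
    unfolding cube_star_chain_def rees_star_def
    by (simp only: gorder.simps prod.case le_remove_bottom_cubical_lattice chain_poset_simps
        poset_rank_cube_face[OF m(1)] poset_rank_cube_face[OF m'(1)] cube_face_subset_iff[OF m(1) m'(1)]
        poset_rank_chain_poset[OF k(1)] poset_rank_chain_poset[OF k(2)])
  then show ?thesis using mono c by auto
qed

lemma inj_on_cube_face_pair:
  "inj_on (\<lambda>(m, k). (cube_face n m, k)) (SIGMA m:{m. dom m \<subseteq> {..<n}}. S m)"
  by (auto simp: inj_on_def dest: cube_face_inj)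

text \<open>
  The bound \<open>k' \<le> n - card (dom m')\<close>, needed for \<open>(cube_face n m', k')\<close> to belong to the product,
  follows from the order relation. Hence the elements above \<open>(cube_face n m, k)\<close> depend on \<open>k\<close>
  only through a translation.
\<close>

lemma above_cube_star_chain:
  assumes m: "dom m \<subseteq> {..<n}" and k: "k \<le> n - card (dom m)"
  shows "{q \<in> carrier (cube_star_chain n). (cube_face n m, k) \<sqsubseteq>\<^bsub>cube_star_chain n\<^esub> q} =
    (\<lambda>(m', k'). (cube_face n m', k')) `
      (SIGMA m':{m'. m' \<subseteq>\<^sub>m m}. {k..k + (card (dom m) - card (dom m'))})"
    (is "?above = ?pt ` ?S")
proof (intro equalityI subsetI)
  have le: "(cube_face n m, k) \<sqsubseteq>\<^bsub>cube_star_chain n\<^esub> (cube_face n m', k') \<longleftrightarrow>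
      m' \<subseteq>\<^sub>m m \<and> k \<le> k' \<and> k' \<le> k + (card (dom m) - card (dom m'))"
    if "dom m' \<subseteq> {..<n}" "k' \<le> n - card (dom m')" for m' k'
    using that m k by (intro le_cube_star_chain_iff) auto
  {
    fix q assume q: "q \<in> ?above"
    then obtain m' k' where m': "dom m' \<subseteq> {..<n}" "k' \<le> n - card (dom m')"
      and qeq: "q = (cube_face n m', k')"
      unfolding carrier_cube_star_chain by auto
    have "(m', k') \<in> ?S" using q le[OF m'] unfolding qeq by simp
    then show "q \<in> ?pt ` ?S" unfolding qeq by (rule rev_image_eqI) simp
  next
    fix q assume "q \<in> ?pt ` ?S"
    then obtain m' k' where qeq: "q = (cube_face n m', k')" and le_m: "m' \<subseteq>\<^sub>m m"
      and k': "k \<le> k'" "k' \<le> k + (card (dom m) - card (dom m'))" by auto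
    have "dom m' \<subseteq> dom m" using le_m by (rule map_le_implies_dom_le)
    moreover have "finite (dom m)" using m finite_subset by blast
    ultimately have c: "card (dom m') \<le> card (dom m)" and m': "dom m' \<subseteq> {..<n}"
      using m by (auto intro: card_mono)
    have "card (dom m) \<le> n" using card_mono[OF _ m] by simp
    then have k'n: "k' \<le> n - card (dom m')" using k k' c by linarith
    show "q \<in> ?above"
      using le[OF m' k'n] mem_cube_star_chain_iff[OF m'] k'n le_m k' unfolding qeq by simp
  }
qed

lemma finite_carrier_cube_star_chain: "finite (carrier (cube_star_chain n))"
  unfolding carrier_cube_star_chain
  by (intro finite_imageI finite_SigmaI finite_maps_into_bool) auto

text \<open>
  For a weight that depends only on the codimension of the face, each of the \<open>c choose i\<close> faces
  of codimension \<open>c - i\<close> above a face of codimension \<open>c\<close> contributes \<open>i + 1\<close> times, once for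
  every admissible chain coordinate.
\<close>

lemma sum_above_cube_star_chain:
  fixes h :: "(nat \<Rightarrow>\<^sub>0 real) set \<times> nat \<Rightarrow> int"
  assumes m: "dom m \<subseteq> {..<n}" and k: "k \<le> n - card (dom m)"
    and h: "\<And>m k. dom m \<subseteq> {..<n} \<Longrightarrow> h (cube_face n m, k) = f (card (dom m))"
  shows "(\<Sum>q\<in>{q \<in> carrier (cube_star_chain n). (cube_face n m, k) \<sqsubseteq>\<^bsub>cube_star_chain n\<^esub> q}. h q) =
    (\<Sum>i\<le>card (dom m). int (card (dom m) choose i) * (int i + 1) * f (card (dom m) - i))"
proof -
  let ?c = "card (dom m)"
  let ?N = "{m'. m' \<subseteq>\<^sub>m m}"
  let ?S = "SIGMA m':?N. {k..k + (?c - card (dom m'))}"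
  have N: "dom m' \<subseteq> {..<n}" if "m' \<in> ?N" for m'
    using that m map_le_implies_dom_le by blast
  have fin: "finite (dom m)" using m finite_subset by blast
  have finN: "finite ?N"
    by (rule finite_subset[OF _ finite_maps_into_bool[of "{..<n}"]]) (use N in auto)
  have inj: "inj_on (\<lambda>(m', k'). (cube_face n m', k')) ?S"
    by (rule inj_on_subset[OF inj_on_cube_face_pair]) (use N in auto)
  have "(\<Sum>q\<in>{q \<in> carrier (cube_star_chain n). (cube_face n m, k) \<sqsubseteq>\<^bsub>cube_star_chain n\<^esub> q}. h q) =
      (\<Sum>(m', k')\<in>?S. h (cube_face n m', k'))"
    unfolding above_cube_star_chain[OF m k] sum.reindex[OF inj]
    by (simp add: case_prod_beta comp_def)
  also have "\<dots> = (\<Sum>m'\<in>?N. \<Sum>k'\<in>{k..k + (?c - card (dom m'))}. h (cube_face n m', k'))"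
    using finN by (simp add: sum.Sigma)
  also have "\<dots> = (\<Sum>m'\<in>?N. (int (?c - card (dom m')) + 1) * f (card (dom m')))"
  proof (intro sum.cong refl)
    fix m' assume "m' \<in> ?N"
    then have "(\<Sum>k'\<in>{k..k + (?c - card (dom m'))}. h (cube_face n m', k')) =
        (\<Sum>k'\<in>{k..k + (?c - card (dom m'))}. f (card (dom m')))"
      by (simp add: h N)
    then show "(\<Sum>k'\<in>{k..k + (?c - card (dom m'))}. h (cube_face n m', k')) =
        (int (?c - card (dom m')) + 1) * f (card (dom m'))"
      by (simp add: algebra_simps)
  qed
  also have "\<dots> = (\<Sum>j\<le>?c. int (?c choose j) * ((int (?c - j) + 1) * f j))"
    by (rule sum_submaps[OF fin])
  also have "\<dots> = (\<Sum>i\<le>?c. int (?c choose i) * (int i + 1) * f (?c - i))"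
    by (rule sum.reindex_bij_witness[of _ "\<lambda>i. ?c - i" "\<lambda>i. ?c - i"])
      (auto simp: binomial_symmetric[symmetric] mult.assoc)
  finally show ?thesis .
qed

text \<open>
  The cube has \<open>2 ^ (n - i) * (n choose i)\<close> faces of dimension \<open>i\<close>, and each is paired with the
  \<open>i + 1\<close> chain elements of rank at most \<open>i\<close>.
\<close>

lemma sum_cube_star_chain:
  fixes h :: "(nat \<Rightarrow>\<^sub>0 real) set \<times> nat \<Rightarrow> int"
  assumes h: "\<And>m k. dom m \<subseteq> {..<n} \<Longrightarrow> h (cube_face n m, k) = f (card (dom m))"
  shows "(\<Sum>q\<in>carrier (cube_star_chain n). h q) =
    (\<Sum>i\<le>n. 2 ^ (n - i) * int (n choose i) * (int i + 1) * f (n - i))"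
proof -
  let ?M = "{m :: nat \<rightharpoonup> bool. dom m \<subseteq> {..<n}}"
  have "(\<Sum>q\<in>carrier (cube_star_chain n). h q) =
      (\<Sum>(m, k)\<in>(SIGMA m:?M. {..n - card (dom m)}). h (cube_face n m, k))"
    unfolding carrier_cube_star_chain sum.reindex[OF inj_on_cube_face_pair]
    by (simp add: case_prod_beta comp_def)
  also have "\<dots> = (\<Sum>m\<in>?M. \<Sum>k\<le>n - card (dom m). h (cube_face n m, k))"
    by (simp add: sum.Sigma finite_maps_into_bool)
  also have "\<dots> = (\<Sum>m\<in>?M. (int (n - card (dom m)) + 1) * f (card (dom m)))"
    by (intro sum.cong refl) (simp add: h algebra_simps)
  also have "\<dots> = (\<Sum>j\<le>n. int (n choose j) * (2 ^ j * ((int (n - j) + 1) * f j)))"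
    using sum_maps_into_bool[of "{..<n}" "\<lambda>j. (int (n - j) + 1) * f j"] by simp
  also have "\<dots> = (\<Sum>i\<le>n. 2 ^ (n - i) * int (n choose i) * (int i + 1) * f (n - i))"
    by (rule sum.reindex_bij_witness[of _ "\<lambda>i. n - i" "\<lambda>i. n - i"])
      (auto simp: binomial_symmetric[symmetric] mult_ac)
  finally show ?thesis .
qed

theorem proposition3p2:
  fixes n :: nat
  shows "moebius_number (Rees (cubical_lattice n) (chain_poset (n + 1))) =
    - 1 + (\<Sum>i = 0..n. (- 1) ^ (n - i) * 2 ^ (n - i) * int (n choose i) * (int i + 1) * fact (n - i))"
proof -
  \<comment> \<open>The value \<open>- a c\<close> is the Moebius value from an element with a face of codimension \<open>c\<close> to the maximum.\<close>
  define a :: "nat \<Rightarrow> int" where "a c = (- 1) ^ c * fact c" for c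
  define g where "g = (\<lambda>(F, k::nat). - a (n - poset_rank (remove_bottom (cubical_lattice n)) F))"
  have g: "g (cube_face n m, k) = - a (card (dom m))" if "dom m \<subseteq> {..<n}" for m k
    using that card_mono[OF _ that] by (simp add: g_def poset_rank_cube_face)
  have upper: "(\<Sum>q\<in>{q \<in> carrier (cube_star_chain n). p \<sqsubseteq>\<^bsub>cube_star_chain n\<^esub> q}. g q) = - 1"
    if pR: "p \<in> carrier (cube_star_chain n)" for p
  proof -
    obtain m k where m: "dom m \<subseteq> {..<n}" "k \<le> n - card (dom m)" and p: "p = (cube_face n m, k)"
      using pR unfolding carrier_cube_star_chain by auto
    have "(\<Sum>q\<in>{q \<in> carrier (cube_star_chain n). p \<sqsubseteq>\<^bsub>cube_star_chain n\<^esub> q}. g q) =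
        (\<Sum>i\<le>card (dom m). int (card (dom m) choose i) * (int i + 1) * - a (card (dom m) - i))"
      unfolding p by (rule sum_above_cube_star_chain[OF m]) (rule g)
    also have "\<dots> = - 1"
      using alternating_sum_eq_1[of "card (dom m)"] by (simp add: a_def sum_negf)
    finally show ?thesis .
  qed
  have "moebius_number (Rees (cubical_lattice n) (chain_poset (n + 1))) =
      - 1 - (\<Sum>q\<in>carrier (cube_star_chain n). g q)"
    unfolding Rees_def cube_star_chain_def[symmetric]
    by (rule moebius_number_adjoin_bounds[OF partial_order_cube_star_chain
          finite_carrier_cube_star_chain upper])
  also have "(\<Sum>q\<in>carrier (cube_star_chain n). g q) =
      (\<Sum>i\<le>n. 2 ^ (n - i) * int (n choose i) * (int i + 1) * - a (n - i))"
    by (rule sum_cube_star_chain) (rule g)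
  finally show ?thesis by (simp add: a_def sum_negf mult_ac atMost_atLeast0)
qed

end
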